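(* Let $\Omega\subset\mathbb{R}^3$ be a simply connected domain, let $v:\Omega\to\mathbb{C}$ be a function, and let $\xi_1,\xi_2:\Omega\to\mathbb{C}$ be twice continuously differentiable scalar functions such that $\overrightarrow{h}_1=\operatorname{grad}\xi_1$ and $\overrightarrow{h}_2=\operatorname{grad}\xi_2$ are two particular solutions of the Riccati partial differential equation $$D\overrightarrow{f}+\overrightarrow{f}^{2}=v\quad\text{in }\Omega .$$ Let $A\in\mathbb{C}$ and put $w=Ae^{\xi_1-\xi_2}$, where it is assumed that $w(x)\neq1$ for all $x\in\Omega$. Then there exists a scalar function $\varphi:\Omega\to\mathbb{C}$ such that $$\overrightarrow{f}=\nabla\varphi=\frac{\overrightarrow{h}_1w-\overrightarrow{h}_2}{w-1},$$ and this $\overrightarrow{f}$ is also a solution of $D\overrightarrow{f}+\overrightarrow{f}^{2}=v$ in $\Omega$.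
   Context: $\mathbb{H}(\mathbb{C})$ denotes the complex quaternions: elements $a=\sum_{k=0}^{3}a_k i_k$ with $a_k\in\mathbb{C}$, where $i_0=1$ is the unit, $i_k^2=-1$ for $k=1,2,3$, $i_1i_2=-i_2i_1=i_3$, $i_2i_3=-i_3i_2=i_1$, $i_3i_1=-i_1i_3=i_2$, and the complex unit $i$ commutes with every $i_k$. Scalars are identified with multiples of $i_0$; a vector (purely vectorial quaternion) is $\overrightarrow{a}=\sum_{k=1}^{3}a_k i_k$. The quaternionic square of a vector is $\overrightarrow{a}^2=-(a_1^2+a_2^2+a_3^2)$ (no complex conjugation). For a differentiable function $g:\Omega\to\mathbb{H}(\mathbb{C})$, the Moisil-Theodoresco operator is $Dg=\sum_{k=1}^{3}i_k\,\partial_k g$ with $\partial_k=\partial/\partial x_k$; for a scalar function $u$, $Du=\operatorname{grad}u=\nabla u=\sum_{k=1}^3 i_k\partial_k u$, and for a vector function, $D\overrightarrow{g}=-\operatorname{div}\overrightarrow{g}+\operatorname{rot}\overrightarrow{g}$ ($\operatorname{rot}$ is the curl). *)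

theory Defs
  imports "HOL-Analysis.Analysis"
begin

datatype cquat = CQuat (cq0: complex) (cq1: complex) (cq2: complex) (cq3: complex)

lemma cquat_eq_iff:
  "p = q \<longleftrightarrow> cq0 p = cq0 q \<and> cq1 p = cq1 q \<and> cq2 p = cq2 q \<and> cq3 p = cq3 q"
  by (auto intro: cquat.expand)

text \<open>The norm is only there to supply the topology and the notion of derivative; it is the
  Euclidean norm of the coordinates and is not multiplicative.\<close>

instantiation cquat :: "{ring_1, real_algebra_1, real_normed_vector}"
begin

definition "0 = CQuat 0 0 0 0"
definition "1 = CQuat 1 0 0 0"
definition "p + q = CQuat (cq0 p + cq0 q) (cq1 p + cq1 q) (cq2 p + cq2 q) (cq3 p + cq3 q)"
definition "p - q = CQuat (cq0 p - cq0 q) (cq1 p - cq1 q) (cq2 p - cq2 q) (cq3 p - cq3 q)"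
definition "- p = CQuat (- cq0 p) (- cq1 p) (- cq2 p) (- cq3 p)"
definition "r *\<^sub>R p = CQuat (r *\<^sub>R cq0 p) (r *\<^sub>R cq1 p) (r *\<^sub>R cq2 p) (r *\<^sub>R cq3 p)"
definition "p * q = CQuat
  (cq0 p * cq0 q - cq1 p * cq1 q - cq2 p * cq2 q - cq3 p * cq3 q)
  (cq0 p * cq1 q + cq1 p * cq0 q + cq2 p * cq3 q - cq3 p * cq2 q)
  (cq0 p * cq2 q - cq1 p * cq3 q + cq2 p * cq0 q + cq3 p * cq1 q)
  (cq0 p * cq3 q + cq1 p * cq2 q - cq2 p * cq1 q + cq3 p * cq0 q)"
definition "norm p = norm (cq0 p, cq1 p, cq2 p, cq3 p)"
definition "sgn (p :: cquat) = inverse (norm p) *\<^sub>R p"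
definition "dist (p :: cquat) q = norm (p - q)"
definition [code del]:
  "(uniformity :: (cquat \<times> cquat) filter) = (INF e\<in>{0 <..}. principal {(p, q). dist p q < e})"
definition [code del]:
  "open (U :: cquat set) \<longleftrightarrow>
    (\<forall>p\<in>U. eventually (\<lambda>(p', q). p' = p \<longrightarrow> q \<in> U) uniformity)"

lemma cquat_sel_simps [simp]:
  "cq0 0 = 0" "cq1 0 = 0" "cq2 0 = 0" "cq3 0 = 0"
  "cq0 1 = 1" "cq1 1 = 0" "cq2 1 = 0" "cq3 1 = 0"
  "cq0 (p + q) = cq0 p + cq0 q" "cq1 (p + q) = cq1 p + cq1 q"
  "cq2 (p + q) = cq2 p + cq2 q" "cq3 (p + q) = cq3 p + cq3 q"
  "cq0 (p - q) = cq0 p - cq0 q" "cq1 (p - q) = cq1 p - cq1 q"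
  "cq2 (p - q) = cq2 p - cq2 q" "cq3 (p - q) = cq3 p - cq3 q"
  "cq0 (- p) = - cq0 p" "cq1 (- p) = - cq1 p" "cq2 (- p) = - cq2 p" "cq3 (- p) = - cq3 p"
  "cq0 (r *\<^sub>R p) = r *\<^sub>R cq0 p" "cq1 (r *\<^sub>R p) = r *\<^sub>R cq1 p"
  "cq2 (r *\<^sub>R p) = r *\<^sub>R cq2 p" "cq3 (r *\<^sub>R p) = r *\<^sub>R cq3 p"
  by (simp_all add: zero_cquat_def one_cquat_def plus_cquat_def minus_cquat_def
      uminus_cquat_def scaleR_cquat_def)

lemma cquat_sel_times:
  "cq0 (p * q) = cq0 p * cq0 q - cq1 p * cq1 q - cq2 p * cq2 q - cq3 p * cq3 q"
  "cq1 (p * q) = cq0 p * cq1 q + cq1 p * cq0 q + cq2 p * cq3 q - cq3 p * cq2 q"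
  "cq2 (p * q) = cq0 p * cq2 q - cq1 p * cq3 q + cq2 p * cq0 q + cq3 p * cq1 q"
  "cq3 (p * q) = cq0 p * cq3 q + cq1 p * cq2 q - cq2 p * cq1 q + cq3 p * cq0 q"
  by (simp_all add: times_cquat_def)

instance
proof
  fix p q s :: cquat and a b :: real
  show "norm (p + q) \<le> norm p + norm q"
    using norm_triangle_ineq[of "(cq0 p, cq1 p, cq2 p, cq3 p)" "(cq0 q, cq1 q, cq2 q, cq3 q)"]
    by (simp add: norm_cquat_def)
  show "norm (a *\<^sub>R p) = \<bar>a\<bar> * norm p"
    using norm_scaleR[of a "(cq0 p, cq1 p, cq2 p, cq3 p)"]
    by (simp add: norm_cquat_def)
  show "(norm p = 0) = (p = 0)"
    unfolding norm_cquat_def norm_eq_zero by (simp add: cquat_eq_iff zero_prod_def)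
qed (simp_all add: cquat_eq_iff cquat_sel_times sgn_cquat_def dist_cquat_def
      uniformity_cquat_def open_cquat_def algebra_simps scaleR_add_left scaleR_add_right)

end

definition scal :: "complex \<Rightarrow> cquat" where
  "scal c = CQuat c 0 0 0"

definition vectorial :: "cquat \<Rightarrow> bool" where
  "vectorial q \<longleftrightarrow> cq0 q = 0"

text \<open>The imaginary units; in type \<open>3\<close> the index 3 is the same element as 0.\<close>

definition iunit :: "3 \<Rightarrow> cquat" where
  "iunit k = CQuat 0 (of_bool (k = 1)) (of_bool (k = 2)) (of_bool (k = 3))"

lemma iunit_table:
  "iunit k * iunit k = -1"
  "iunit 1 * iunit 2 = iunit 3" "iunit 2 * iunit 1 = - iunit 3"
  "iunit 2 * iunit 3 = iunit 1" "iunit 3 * iunit 2 = - iunit 1"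
  "iunit 3 * iunit 1 = iunit 2" "iunit 1 * iunit 3 = - iunit 2"
  "scal c * q = q * scal c"
  using exhaust_3[of k] by (auto simp: cquat_eq_iff cquat_sel_times iunit_def scal_def)

lemma cquat_expansion:
  "q = scal (cq0 q) + scal (cq1 q) * iunit 1 + scal (cq2 q) * iunit 2 + scal (cq3 q) * iunit 3"
  by (auto simp: cquat_eq_iff cquat_sel_times iunit_def scal_def)

lemma vectorial_square:
  "vectorial q \<Longrightarrow> q\<^sup>2 = scal (- ((cq1 q)\<^sup>2 + (cq2 q)\<^sup>2 + (cq3 q)\<^sup>2))"
  by (auto simp: cquat_eq_iff cquat_sel_times scal_def vectorial_def power2_eq_square)

definition partial :: "3 \<Rightarrow> (real^3 \<Rightarrow> 'b::real_normed_vector) \<Rightarrow> real^3 \<Rightarrow> 'b" where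
  "partial k g x = vector_derivative (\<lambda>t. g (x + t *\<^sub>R axis k 1)) (at 0)"

definition moisil_theodoresco :: "(real^3 \<Rightarrow> cquat) \<Rightarrow> real^3 \<Rightarrow> cquat" where
  "moisil_theodoresco g x = (\<Sum>k\<in>UNIV. iunit k * partial k g x)"

definition grad :: "(real^3 \<Rightarrow> complex) \<Rightarrow> real^3 \<Rightarrow> cquat" where
  "grad u x = (\<Sum>k\<in>UNIV. iunit k * scal (partial k u x))"

definition twice_cont_differentiable_on ::
    "('a::euclidean_space \<Rightarrow> 'b::real_normed_vector) \<Rightarrow> 'a set \<Rightarrow> bool" where
  "twice_cont_differentiable_on u S \<longleftrightarrow>
    (\<exists>(u' :: 'a \<Rightarrow> 'a \<Rightarrow>\<^sub>L 'b) (u'' :: 'a \<Rightarrow> 'a \<Rightarrow>\<^sub>L ('a \<Rightarrow>\<^sub>L 'b)).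
      (\<forall>x\<in>S. (u has_derivative blinfun_apply (u' x)) (at x)) \<and>
      (\<forall>x\<in>S. (u' has_derivative blinfun_apply (u'' x)) (at x)) \<and>
      continuous_on S u'')"

definition riccati_solution ::
    "(real^3) set \<Rightarrow> (real^3 \<Rightarrow> complex) \<Rightarrow> (real^3 \<Rightarrow> cquat) \<Rightarrow> bool" where
  "riccati_solution \<Omega> v f \<longleftrightarrow>
    (\<forall>x\<in>\<Omega>. f differentiable (at x) \<and> vectorial (f x) \<and>
      moisil_theodoresco f x + (f x)\<^sup>2 = scal (v x))"

end

theory Submission imports Defs begin

text \<open>Writing \<open>s = w / (w - 1)\<close> and \<open>u = h1 - h2\<close>, one has \<open>f = h2 + s u\<close>. As \<open>grad w = w u\<close>, a
  potential of \<open>f\<close> is \<open>\<xi>2 + log (w - 1)\<close>, where the logarithm exists by simple connectedness. In the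
  Riccati equation \<open>D (s u) = grad s u + s D u\<close> with \<open>grad s = - w u / (w - 1)\<^sup>2\<close>, and all terms
  cancel because \<open>s\<^sup>2 - s = w / (w - 1)\<^sup>2\<close>.\<close>

section \<open>Derivatives of functions with values in the complex quaternions\<close>

lemma bounded_bilinear_scal_times: "bounded_bilinear (\<lambda>c q. scal c * q)"
proof
  show "\<exists>K. \<forall>c q. norm (scal c * q) \<le> norm c * norm q * K"
  proof (intro exI allI)
    fix c q
    show "norm (scal c * q) \<le> norm c * norm q * 1"
    proof -
      \<comment> \<open>A scalar factor multiplies each coordinate by \<open>c\<close>, so the norm,
        not multiplicative in general, is multiplicative here and the constant 1 suffices.\<close>
      have "norm (scal c * q) = sqrt ((cmod c)\<^sup>2 *
          ((cmod (cq0 q))\<^sup>2 + ((cmod (cq1 q))\<^sup>2 + ((cmod (cq2 q))\<^sup>2 + (cmod (cq3 q))\<^sup>2))))"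
        by (simp add: norm_cquat_def norm_prod_def cquat_sel_times scal_def norm_mult
            power_mult_distrib distrib_left)
      then show ?thesis
        by (simp add: real_sqrt_mult norm_cquat_def norm_prod_def)
    qed
  qed
qed (simp_all add: cquat_eq_iff cquat_sel_times scal_def algebra_simps)

lemma has_derivative_scal_times:
  assumes "(s has_derivative s') (at x)" and "(u has_derivative u') (at x)"
  shows "((\<lambda>y. scal (s y) * u y) has_derivative
    (\<lambda>d. scal (s x) * u' d + scal (s' d) * u x)) (at x)"
  using bounded_bilinear.FDERIV[OF bounded_bilinear_scal_times assms] .

text \<open>The chain rule along the line through \<open>x\<close> in direction
  \<open>axis k 1\<close>. It reduces identities for \<open>grad\<close> and
  \<open>moisil_theodoresco\<close> to algebra with the total derivative.\<close>

lemma partial_has_derivative: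
  assumes "(g has_derivative g') (at x)"
  shows "partial k g x = g' (axis k 1)"
proof -
  have "((\<lambda>t. x + t *\<^sub>R axis k 1) has_derivative (\<lambda>t. t *\<^sub>R axis k 1)) (at (0::real))"
    by (auto intro!: derivative_eq_intros)
  then have "((\<lambda>t. g (x + t *\<^sub>R axis k 1)) has_derivative (\<lambda>t. g' (t *\<^sub>R axis k 1))) (at (0::real))"
    using has_derivative_compose[where g=g and g'=g'] assms by fastforce
  then have "((\<lambda>t. g (x + t *\<^sub>R axis k 1)) has_vector_derivative g' (axis k 1)) (at 0)"
    by (simp add: has_vector_derivative_def linear_cmul[OF has_derivative_linear[OF assms]])
  then show ?thesis
    unfolding partial_def by (rule vector_derivative_at)
qed

lemma moisil_theodoresco_has_derivative:
  assumes "(g has_derivative g') (at x)"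
  shows "moisil_theodoresco g x = (\<Sum>k\<in>UNIV. iunit k * g' (axis k 1))"
  by (simp add: moisil_theodoresco_def partial_has_derivative[OF assms])

lemma grad_has_derivative:
  assumes "(g has_derivative g') (at x)"
  shows "grad g x = (\<Sum>k\<in>UNIV. iunit k * scal (g' (axis k 1)))"
  by (simp add: grad_def partial_has_derivative[OF assms])

lemma scal_simps:
  "scal (a + b) = scal a + scal b" "scal (a - b) = scal a - scal b"
  "scal (a * b) = scal a * scal b" "scal (- a) = - scal a" "scal 0 = 0"
  by (simp_all add: cquat_eq_iff cquat_sel_times scal_def)

lemma scal_left_commute: "q * (scal c * p) = scal c * (q * p)"
  by (metis iunit_table(8) mult.assoc)

text \<open>The Leibniz rule survives noncommutativity because \<open>scal (s x)\<close> is central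
  and can be moved past each \<open>iunit k\<close>. In the other term the units stay to the left of
  \<open>u x\<close> and assemble into \<open>grad s x\<close>.\<close>

lemma moisil_theodoresco_scal_times:
  assumes "s differentiable (at x)" and "u differentiable (at x)"
  shows "moisil_theodoresco (\<lambda>y. scal (s y) * u y) x
    = grad s x * u x + scal (s x) * moisil_theodoresco u x"
proof -
  obtain s' u' where s: "(s has_derivative s') (at x)" and u: "(u has_derivative u') (at x)"
    using assms by (auto simp: differentiable_def)
  show ?thesis
    unfolding moisil_theodoresco_has_derivative[OF has_derivative_scal_times[OF s u]]
      moisil_theodoresco_has_derivative[OF u] grad_has_derivative[OF s]
    by (simp add: sum_distrib_left sum_distrib_right sum.distrib distrib_left scal_left_commute
        mult.assoc add.commute)
qed

lemma moisil_theodoresco_add: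
  assumes "g differentiable (at x)" and "h differentiable (at x)"
  shows "moisil_theodoresco (\<lambda>y. g y + h y) x = moisil_theodoresco g x + moisil_theodoresco h x"
proof -
  obtain g' h' where g: "(g has_derivative g') (at x)" and h: "(h has_derivative h') (at x)"
    using assms by (auto simp: differentiable_def)
  show ?thesis
    by (simp add: moisil_theodoresco_has_derivative[OF has_derivative_add[OF g h]]
        moisil_theodoresco_has_derivative[OF g] moisil_theodoresco_has_derivative[OF h]
        distrib_left sum.distrib)
qed

lemma moisil_theodoresco_diff:
  assumes "g differentiable (at x)" and "h differentiable (at x)"
  shows "moisil_theodoresco (\<lambda>y. g y - h y) x = moisil_theodoresco g x - moisil_theodoresco h x"
proof -
  obtain g' h' where g: "(g has_derivative g') (at x)" and h: "(h has_derivative h') (at x)"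
    using assms by (auto simp: differentiable_def)
  show ?thesis
    by (simp add: moisil_theodoresco_has_derivative[OF has_derivative_diff[OF g h]]
        moisil_theodoresco_has_derivative[OF g] moisil_theodoresco_has_derivative[OF h]
        right_diff_distrib sum_subtractf)
qed

text \<open>Derivatives depend only on values near the point. This lets a formula for
  \<open>f\<close> valid only on \<Omega> be differentiated there.\<close>

lemma moisil_theodoresco_cong_open:
  assumes "open S" "x \<in> S" "\<And>y. y \<in> S \<Longrightarrow> g y = h y" "h differentiable (at x)"
  shows "g differentiable (at x)" "moisil_theodoresco g x = moisil_theodoresco h x"
proof -
  obtain h' where h: "(h has_derivative h') (at x)"
    using assms(4) by (auto simp: differentiable_def)
  then have g: "(g has_derivative h') (at x)"
    by (rule has_derivative_transform_within_open[OF _ assms(1,2)]) (simp add: assms(3))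
  show "g differentiable (at x)"
    using g by (rule differentiableI)
  show "moisil_theodoresco g x = moisil_theodoresco h x"
    by (simp add: moisil_theodoresco_has_derivative[OF g] moisil_theodoresco_has_derivative[OF h])
qed

lemma grad_add:
  assumes "a differentiable (at x)" and "b differentiable (at x)"
  shows "grad (\<lambda>y. a y + b y) x = grad a x + grad b x"
proof -
  obtain a' b' where a: "(a has_derivative a') (at x)" and b: "(b has_derivative b') (at x)"
    using assms by (auto simp: differentiable_def)
  show ?thesis
    by (simp add: grad_has_derivative[OF has_derivative_add[OF a b]]
        grad_has_derivative[OF a] grad_has_derivative[OF b] scal_simps distrib_left sum.distrib)
qed

lemma grad_diff:
  assumes "a differentiable (at x)" and "b differentiable (at x)"
  shows "grad (\<lambda>y. a y - b y) x = grad a x - grad b x"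
proof -
  obtain a' b' where a: "(a has_derivative a') (at x)" and b: "(b has_derivative b') (at x)"
    using assms by (auto simp: differentiable_def)
  show ?thesis
    by (simp add: grad_has_derivative[OF has_derivative_diff[OF a b]]
        grad_has_derivative[OF a] grad_has_derivative[OF b] scal_simps right_diff_distrib
        sum_subtractf)
qed

section \<open>Gradients of compositions and of logarithms\<close>

lemma grad_chain_open:
  assumes "open S" "x \<in> S" "\<And>y. y \<in> S \<Longrightarrow> b y = F (a y)"
    and "a differentiable (at x)" and "(F has_field_derivative c) (at (a x))"
  shows "b differentiable (at x)" "grad b x = scal c * grad a x"
proof -
  obtain a' where a: "(a has_derivative a') (at x)"
    using assms(4) by (auto simp: differentiable_def)
  \<comment> \<open>The real derivative of \<open>F\<close> at \<open>a x\<close> is complex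
    multiplication by \<open>c\<close>.\<close>
  have "((\<lambda>y. F (a y)) has_derivative (\<lambda>d. c * a' d)) (at x)"
    using has_derivative_compose[OF a has_field_derivative_imp_has_derivative[OF assms(5)]] .
  then have b: "(b has_derivative (\<lambda>d. c * a' d)) (at x)"
    by (rule has_derivative_transform_within_open[OF _ assms(1,2)]) (simp add: assms(3))
  show "b differentiable (at x)"
    using b by (rule differentiableI)
  show "grad b x = scal c * grad a x"
    by (simp add: grad_has_derivative[OF a] grad_has_derivative[OF b] scal_simps
        sum_distrib_left scal_left_commute)
qed

text \<open>A merely continuous logarithm is differentiable where \<open>F\<close> is: near
  \<open>x\<close> it differs by a constant from the principal branch applied to
  \<open>F y / F x\<close>.\<close>

lemma logarithm_grad:
  fixes F g :: "real^3 \<Rightarrow> complex"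
  assumes "open S" "x \<in> S" "continuous_on S g" "\<And>y. y \<in> S \<Longrightarrow> F y = exp (g y)"
    and "F differentiable (at x)"
  shows "g differentiable (at x)" "grad g x = scal (inverse (F x)) * grad F x"
proof -
  \<comment> \<open>On \<open>T\<close> the imaginary part of \<open>g y - g x\<close> has absolute
    value below \<open>pi\<close>, so \<open>Ln\<close> inverts \<open>exp\<close> there.\<close>
  define T where "T = S \<inter> g -` ball (g x) pi"
  have T: "open T" "x \<in> T"
    unfolding T_def using assms(1-3) by (auto intro: continuous_open_preimage)
  have loc: "g y = g x + Ln (F y / F x)" if "y \<in> T" for y
  proof -
    have "\<bar>Im (g y - g x)\<bar> < pi"
      using that abs_Im_le_cmod[of "g y - g x"] by (auto simp: T_def dist_norm norm_minus_commute)
    then have "Ln (exp (g y - g x)) = g y - g x"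
      by (intro Ln_exp) auto
    then show ?thesis
      using that assms(2,4) by (simp add: T_def exp_diff)
  qed
  have "F x \<noteq> 0"
    using assms(2,4) by simp
  \<comment> \<open>At \<open>z = F x\<close> the quotient is 1, which lies off the branch cut of
    \<open>Ln\<close>.\<close>
  then have "((\<lambda>z. g x + Ln (z / F x)) has_field_derivative inverse (F x)) (at (F x))"
    by (auto intro!: derivative_eq_intros simp: field_simps)
  from grad_chain_open[OF T, of g "\<lambda>z. g x + Ln (z / F x)" F, OF loc assms(5) this]
  show "g differentiable (at x)" "grad g x = scal (inverse (F x)) * grad F x"
    by auto
qed

lemma twice_cont_differentiable_on_imp_differentiable:
  "twice_cont_differentiable_on u S \<Longrightarrow> x \<in> S \<Longrightarrow> u differentiable (at x)"
  unfolding twice_cont_differentiable_on_def by (blast intro: differentiableI)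

theorem proposition5:
  fixes \<Omega> :: "(real^3) set"
    and v \<xi>1 \<xi>2 w :: "real^3 \<Rightarrow> complex"
    and h1 h2 f :: "real^3 \<Rightarrow> cquat"
    and A :: complex
  assumes "open \<Omega>" and "connected \<Omega>" and "simply_connected \<Omega>"
    and "twice_cont_differentiable_on \<xi>1 \<Omega>" and "twice_cont_differentiable_on \<xi>2 \<Omega>"
    and "\<And>x. x \<in> \<Omega> \<Longrightarrow> h1 x = grad \<xi>1 x" and "\<And>x. x \<in> \<Omega> \<Longrightarrow> h2 x = grad \<xi>2 x"
    and "riccati_solution \<Omega> v h1" and "riccati_solution \<Omega> v h2"
    and "\<And>x. x \<in> \<Omega> \<Longrightarrow> w x = A * exp (\<xi>1 x - \<xi>2 x)"
    and "\<And>x. x \<in> \<Omega> \<Longrightarrow> w x \<noteq> 1"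
    and "\<And>x. x \<in> \<Omega> \<Longrightarrow> f x = scal (inverse (w x - 1)) * (h1 x * scal (w x) - h2 x)"
  shows "(\<exists>\<phi> :: real^3 \<Rightarrow> complex. \<forall>x\<in>\<Omega>. \<phi> differentiable (at x) \<and> f x = grad \<phi> x)
    \<and> riccati_solution \<Omega> v f"
proof -
  have diff_\<xi>: "\<xi>1 differentiable (at x)" "\<xi>2 differentiable (at x)" if "x \<in> \<Omega>" for x
    using assms(4,5) that by (blast intro: twice_cont_differentiable_on_imp_differentiable)+
  have diff_h: "h1 differentiable (at x)" "h2 differentiable (at x)"
    and vec_h: "vectorial (h1 x)" "vectorial (h2 x)"
    and eq_h: "moisil_theodoresco h1 x = scal (v x) - (h1 x)\<^sup>2"
      "moisil_theodoresco h2 x = scal (v x) - (h2 x)\<^sup>2" if "x \<in> \<Omega>" for x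
    using assms(8,9) that by (auto simp: riccati_solution_def eq_diff_eq)
  define u where "u = (\<lambda>x. h1 x - h2 x)"
  define s where "s = (\<lambda>x. w x / (w x - 1))"
  have grad_w: "w differentiable (at x)" "grad w x = scal (w x) * u x" if "x \<in> \<Omega>" for x
  proof -
    \<comment> \<open>The exponential reproduces itself, so the outer derivative at this point is
      \<open>w x\<close> again.\<close>
    have "((\<lambda>z. A * exp z) has_field_derivative w x) (at (\<xi>1 x - \<xi>2 x))"
      using that by (auto intro!: derivative_eq_intros simp: assms(10))
    from grad_chain_open[OF assms(1) that, of w "\<lambda>z. A * exp z" "\<lambda>y. \<xi>1 y - \<xi>2 y", OF assms(10) _ this] diff_\<xi>[OF that]
    show "w differentiable (at x)" "grad w x = scal (w x) * u x"
      using that by (simp_all add: differentiable_diff grad_diff u_def assms(6,7))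
  qed
  have f_eq: "f x = h2 x + scal (s x) * u x" if "x \<in> \<Omega>" for x
  proof -
    \<comment> \<open>This scalar identity is applied to each coordinate, with \<open>a\<close> and
      \<open>b\<close> those of \<open>h1 x\<close> and \<open>h2 x\<close>.\<close>
    have "inverse (w x - 1) * (a * w x - b) = b + s x * (a - b)" for a b
      using assms(11)[OF that] by (simp add: s_def divide_simps) (simp add: algebra_simps)
    then show ?thesis
      by (simp add: assms(12)[OF that] u_def cquat_eq_iff cquat_sel_times scal_def)
  qed

  \<comment> \<open>A potential of \<open>f\<close>\<close>
  have "\<exists>\<phi>. \<forall>x\<in>\<Omega>. \<phi> differentiable (at x) \<and> f x = grad \<phi> x"
  proof -
    have "continuous_on \<Omega> w"
      using grad_w(1) by (metis continuous_at_imp_continuous_on differentiable_imp_continuous_within)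
    then have "continuous_on \<Omega> (\<lambda>x. w x - 1)"
      by (intro continuous_intros)
    then obtain g where g: "continuous_on \<Omega> g" "\<And>x. x \<in> \<Omega> \<Longrightarrow> w x - 1 = exp (g x)"
      using continuous_logarithm_on_simply_connected[OF _ assms(3)
          open_imp_locally_path_connected[OF assms(1)], of "\<lambda>x. w x - 1"] assms(11)
      by auto
    have "(\<lambda>x. \<xi>2 x + g x) differentiable (at x) \<and> f x = grad (\<lambda>x. \<xi>2 x + g x) x"
      if "x \<in> \<Omega>" for x
    proof -
      \<comment> \<open>Subtracting 1 keeps the gradient, so the logarithm \<open>g\<close> of
        \<open>w - 1\<close> has gradient \<open>w u / (w - 1) = s u\<close>.\<close>
      have "((\<lambda>z. z - 1) has_field_derivative 1) (at (w x))"
        by (auto intro!: derivative_eq_intros)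
      note w1 = grad_chain_open[OF assms(1) that, of "\<lambda>y. w y - 1" "\<lambda>z. z - 1" w,
          OF refl grad_w(1)[OF that] this]
      note dg = logarithm_grad[OF assms(1) that g w1(1)]
      have "grad g x = scal (s x) * u x"
        by (simp add: dg(2) w1(2) grad_w(2)[OF that] s_def cquat_eq_iff cquat_sel_times scal_def
            field_simps)
      then show ?thesis
        using diff_\<xi>(2)[OF that] dg(1)
        by (simp add: grad_add f_eq[OF that] assms(7)[OF that] differentiable_add)
    qed
    then show ?thesis
      by blast
  qed

  \<comment> \<open>The Riccati equation for \<open>f\<close>\<close>
  moreover have "riccati_solution \<Omega> v f"
    unfolding riccati_solution_def
  proof (intro ballI)
    fix x assume x: "x \<in> \<Omega>"
    \<comment> \<open>This number enters twice: \<open>grad s\<close> equals \<open>- c u\<close>,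
      and \<open>c\<close> is the excess of the square of \<open>s\<close> over \<open>s\<close>.
      The identity below is stated with \<open>t = w x - 1\<close>.\<close>
    define c where "c = w x / (w x - 1)\<^sup>2"
    have "(t + 1) / t * ((t + 1) / t) = (t + 1) / t + (t + 1) / t\<^sup>2" if "t \<noteq> 0" for t :: complex
      using that by (simp add: field_simps power2_eq_square)
    from this[of "w x - 1"] have sc: "s x * s x = s x + c"
      using assms(11)[OF x] by (simp add: s_def c_def)
    have "((\<lambda>z. z / (z - 1)) has_field_derivative (- 1 / (w x - 1)\<^sup>2)) (at (w x))"
      using assms(11)[OF x] by (auto intro!: derivative_eq_intros simp: field_simps power2_eq_square)
    note ds = grad_chain_open[OF assms(1) x, of s "\<lambda>z. z / (z - 1)" w,
        OF _ grad_w(1)[OF x] this, unfolded s_def, OF refl, folded s_def]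
    have grad_s: "grad s x = - (scal c * u x)"
      by (simp add: ds(2) grad_w(2)[OF x] c_def cquat_eq_iff cquat_sel_times scal_def)
    have du: "u differentiable (at x)"
      using diff_h[OF x] by (simp add: u_def differentiable_diff)
    have dsu: "(\<lambda>y. scal (s y) * u y) differentiable (at x)"
      using ds(1) du has_derivative_scal_times by (fastforce simp: differentiable_def)
    note df = moisil_theodoresco_cong_open[OF assms(1) x f_eq
        differentiable_add[OF diff_h(2)[OF x] dsu]]
    \<comment> \<open>Subtracting the two Riccati equations eliminates \<open>v\<close>.\<close>
    have Du: "moisil_theodoresco u x = (h2 x)\<^sup>2 - (h1 x)\<^sup>2"
      unfolding u_def using diff_h[OF x] by (simp add: moisil_theodoresco_diff eq_h[OF x])
    have "moisil_theodoresco f x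
        = scal (v x) - (h2 x)\<^sup>2 - scal c * (u x)\<^sup>2 + scal (s x) * ((h2 x)\<^sup>2 - (h1 x)\<^sup>2)"
      by (simp add: df(2) moisil_theodoresco_add[OF diff_h(2)[OF x] dsu]
          moisil_theodoresco_scal_times[OF ds(1) du] grad_s Du eq_h[OF x] power2_eq_square
          mult.assoc)
    \<comment> \<open>Since \<open>h2 x\<close> and \<open>u x\<close> need not commute, both mixed
      products are kept.\<close>
    moreover have "(f x)\<^sup>2 = (h2 x)\<^sup>2 + scal (s x) * (h2 x * u x + u x * h2 x)
        + scal (s x * s x) * (u x)\<^sup>2"
      by (simp add: f_eq[OF x] power2_eq_square distrib_left distrib_right scal_simps
          scal_left_commute[of "h2 x"] scal_left_commute[of "u x"] mult.assoc)
    moreover have "(h1 x)\<^sup>2 = (h2 x)\<^sup>2 + (h2 x * u x + u x * h2 x) + (u x)\<^sup>2"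
      by (simp add: u_def power2_eq_square algebra_simps)
    \<comment> \<open>Expanding the square of \<open>h1 = h2 + u\<close> cancels the mixed products,
      and the square of \<open>u\<close> is left with coefficient
      \<open>- c - s + (s + c) = 0\<close>.\<close>
    ultimately have "moisil_theodoresco f x + (f x)\<^sup>2 = scal (v x)"
      unfolding sc by (simp add: scal_simps algebra_simps)
    moreover have "vectorial (f x)"
      using vec_h[OF x] by (simp add: f_eq[OF x] u_def vectorial_def cquat_sel_times scal_def)
    ultimately show "f differentiable (at x) \<and> vectorial (f x)
        \<and> moisil_theodoresco f x + (f x)\<^sup>2 = scal (v x)"
      using df(1) by blast
  qed
  ultimately show ?thesis
    by blast
qed

end
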